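(* Let $k \ge 1$ and $0<\alpha\le 1$. Let $\sum a_n$ be an infinite series, let $(\varphi_n)_{n\ge1}$ be a sequence of complex numbers, and for $n\ge 1$ let $t_n^\alpha=\frac{1}{A_n^\alpha}\sum_{v=1}^{n}A_{n-v}^{\alpha-1}\,v a_v$ be the $n$th Cesàro mean of order $\alpha$ of the sequence $(na_n)$, where $A_n^\alpha$ denotes the Cesàro numbers. Let $(X_n)_{n\ge1}$ be an almost increasing sequence and let $(\lambda_n)_{n\ge1}$ be a sequence such that $$|\lambda_n|\,X_n=O(1)\quad\text{as } n\to\infty .$$ Suppose that there exists a sequence of numbers $(A_n)_{n\ge1}$ (not to be confused with the Cesàro numbers $A_n^\alpha$) which is $\delta$-quasi-monotone (for some sequence $(\delta_n)$ of positive numbers), such that $\sum_{n} nA_nX_n$ is convergent and $|\Delta\lambda_n|\le |A_n|$ for all $n$. Suppose further that there exists $\epsilon>0$ with $k\alpha+\epsilon>1$ such that the sequence $(n^{\epsilon-k}|\varphi_n|^k)$ is non-increasing, and that the sequence $(w_n^\alpha)$ defined by $$w_n^\alpha=\begin{cases}|t_n^\alpha|, & \alpha=1,\\ \max_{1\le v\le n}|t_v^\alpha|, & 0<\alpha<1,\end{cases}$$ satisfies $$\sum_{n=1}^{m} n^{-k}\left(w_n^\alpha|\varphi_n|\right)^k=O(X_m)\quad\text{as } m\to\infty .$$ Then the series $\sum a_n\lambda_n$ is summable $\varphi-|C,\alpha|_k$.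
   Context: Differences: $\Delta b_n=b_n-b_{n+1}$ for any sequence $(b_n)$. Cesàro numbers: for $\beta>-1$, $A_0^\beta=1$, $A_n^\beta=\frac{(\beta+1)(\beta+2)\cdots(\beta+n)}{n!}$ for $n\ge1$ (so $A_n^\beta=O(n^\beta)$), and $A_{-n}^\beta=0$ for $n>0$. Almost increasing: a positive sequence $(b_n)$ is almost increasing if there exist a positive increasing sequence $(c_n)$ and two positive constants $A$ and $B$ such that $A c_n\le b_n\le B c_n$ for all $n$. $\delta$-quasi-monotone: a sequence $(b_n)$ of positive numbers is said to be $\delta$-quasi-monotone if $b_n\to 0$, $b_n>0$ ultimately, and $\Delta b_n\ge-\delta_n$, where $(\delta_n)$ is a sequence of positive numbers. Summability: for a series $\sum u_n$, let $\tau_n^\alpha=\frac{1}{A_n^\alpha}\sum_{v=1}^{n}A_{n-v}^{\alpha-1}\,v u_v$ be the $n$th Cesàro mean of order $\alpha$ $(\alpha>-1)$ of the sequence $(nu_n)$. The series $\sum u_n$ is said to be summable $\varphi-|C,\alpha|_k$, $k\ge1$, if $$\sum_{n=1}^{\infty} n^{-k}\,|\varphi_n\tau_n^\alpha|^k<\infty .$$ In the claim this is applied with $u_n=a_n\lambda_n$. *)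

theory Defs
  imports "HOL-Analysis.Analysis" "HOL-Library.Landau_Symbols"
begin

text \<open>
  All sequences are indexed by \<open>n \<ge> 1\<close> and represented as functions on \<^typ>\<open>nat\<close>; their value
  at \<open>0\<close> is arbitrary and never constrained.
\<close>

definition bdiff :: "(nat \<Rightarrow> 'a::ab_group_add) \<Rightarrow> nat \<Rightarrow> 'a" where
  "bdiff b n = b n - b (Suc n)"

definition cesaro_number :: "real \<Rightarrow> nat \<Rightarrow> real" where
  "cesaro_number \<beta> n = (\<Prod>i=1..n. \<beta> + real i) / fact n"

text \<open>The Cesaro mean of order \<open>\<alpha>\<close> of the sequence \<open>n u\<^sub>n\<close> (not of \<open>u\<^sub>n\<close> itself).\<close>

definition cesaro_mean :: "real \<Rightarrow> (nat \<Rightarrow> complex) \<Rightarrow> nat \<Rightarrow> complex" where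
  "cesaro_mean \<alpha> u n =
     (\<Sum>v=1..n. of_real (cesaro_number (\<alpha> - 1) (n - v)) * of_nat v * u v)
       / of_real (cesaro_number \<alpha> n)"

definition cesaro_max :: "real \<Rightarrow> (nat \<Rightarrow> complex) \<Rightarrow> nat \<Rightarrow> real" where
  "cesaro_max \<alpha> a n =
     (if \<alpha> = 1 then cmod (cesaro_mean \<alpha> a n)
      else Max ((\<lambda>v. cmod (cesaro_mean \<alpha> a v)) ` {1..n}))"

definition almost_increasing :: "(nat \<Rightarrow> real) \<Rightarrow> bool" where
  "almost_increasing b \<longleftrightarrow>
     (\<forall>n\<ge>1. 0 < b n) \<and>
     (\<exists>c A B. (\<forall>n\<ge>1. 0 < c n) \<and> mono_on {1..} c \<and> 0 < A \<and> 0 < B \<and>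
        (\<forall>n\<ge>1. A * c n \<le> b n \<and> b n \<le> B * c n))"

text \<open>
  Positivity of \<open>b\<close> is only required ultimately (as in Boas' definition), which is why absolute
  values of such sequences are meaningful.
\<close>

definition quasi_monotone :: "(nat \<Rightarrow> real) \<Rightarrow> (nat \<Rightarrow> real) \<Rightarrow> bool" where
  "quasi_monotone \<delta> b \<longleftrightarrow>
     (\<forall>n\<ge>1. 0 < \<delta> n) \<and>
     b \<longlonglongrightarrow> 0 \<and> (\<forall>\<^sub>F n in sequentially. 0 < b n) \<and>
     (\<forall>n\<ge>1. bdiff b n \<ge> - \<delta> n)"

text \<open>
  The series starts at \<open>n = 1\<close>, hence the index shift: the summand for \<^term>\<open>n\<close> is the one of
  index \<^term>\<open>Suc n\<close>.
\<close>

definition phi_cesaro_summable ::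
  "(nat \<Rightarrow> complex) \<Rightarrow> real \<Rightarrow> real \<Rightarrow> (nat \<Rightarrow> complex) \<Rightarrow> bool" where
  "phi_cesaro_summable \<phi> \<alpha> k u \<longleftrightarrow>
     summable (\<lambda>n. real (Suc n) powr (- k) * cmod (\<phi> (Suc n) * cesaro_mean \<alpha> u (Suc n)) powr k)"

end

theory Submission
  imports Defs
begin

text \<open>
  Abel summation and Bosanquet's lemma bound the Cesaro mean \<open>T\<^sub>n\<close> of \<open>n a\<^sub>n \<lambda>\<^sub>n\<close> by
  \<open>2 n\<^sup>-\<^sup>\<alpha> \<Sum>v<n. \<bar>\<Delta>\<lambda>\<^sub>v\<bar> v\<^sup>\<alpha> w\<^sub>v\<close> plus \<open>\<bar>\<lambda>\<^sub>n\<bar> w\<^sub>n\<close>. The second part is summed by parts. For the first part,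
  Hoelder's inequality moves the power \<open>k\<close> inside the sum; after interchanging the summations, the
  tail over \<open>n\<close> is controlled by the monotonicity of \<open>n\<^sup>\<epsilon>\<^sup>-\<^sup>k \<bar>\<phi>\<^sub>n\<bar>\<^sup>k\<close> together with \<open>k \<alpha> + \<epsilon> > 1\<close>,
  and what remains is \<open>\<Sum>v \<bar>\<Delta>\<lambda>\<^sub>v\<bar> P\<^sub>v\<close> with \<open>P\<^sub>v = v\<^sup>-\<^sup>k (w\<^sub>v \<bar>\<phi>\<^sub>v\<bar>)\<^sup>k\<close>, which is finite because
  \<open>P\<^sub>v\<close>, an increment of a nonnegative sum of size \<open>O(X\<^sub>v)\<close>, is itself \<open>O(X\<^sub>v)\<close> and \<open>\<Sum>v \<bar>A\<^sub>v\<bar> X\<^sub>v\<close> converges.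
\<close>

section \<open>Cesaro numbers: recursion, signs, sums and convolutions\<close>

lemma cesaro_number_0 [simp]: "cesaro_number \<beta> 0 = 1"
  by (simp add: cesaro_number_def)

lemma cesaro_number_Suc:
  "cesaro_number \<beta> (Suc n) = cesaro_number \<beta> n * (\<beta> + real (Suc n)) / real (Suc n)"
  by (simp add: cesaro_number_def field_simps)

lemma cesaro_number_nonneg: "\<beta> \<ge> -1 \<Longrightarrow> cesaro_number \<beta> n \<ge> 0"
  by (induction n) (auto simp: cesaro_number_Suc)

lemma cesaro_number_pos: "\<beta> > -1 \<Longrightarrow> cesaro_number \<beta> n > 0"
  by (induction n) (auto simp: cesaro_number_Suc)

lemma cesaro_number_mono:
  assumes "\<beta> \<ge> 0" "m \<le> n"
  shows "cesaro_number \<beta> m \<le> cesaro_number \<beta> n"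
proof (rule lift_Suc_mono_le[OF _ assms(2)])
  fix n
  have "cesaro_number \<beta> n \<ge> 0" using assms by (intro cesaro_number_nonneg) auto
  then show "cesaro_number \<beta> n \<le> cesaro_number \<beta> (Suc n)"
    using assms(1) by (simp add: cesaro_number_Suc field_simps)
qed

lemma cesaro_number_minus_one [simp]: "n > 0 \<Longrightarrow> cesaro_number (-1) n = 0"
  by (auto simp: cesaro_number_def intro!: bexI[of _ 1])

text \<open>In this range the factor \<open>\<beta> + 1\<close> is nonpositive and all later factors
  \<open>\<beta> + i\<close> are nonnegative. This sign makes the weights in Bosanquet's lemma
  nonnegative.\<close>

lemma cesaro_number_nonpos:
  assumes "-2 \<le> \<beta>" "\<beta> \<le> -1" "n > 0"
  shows "cesaro_number \<beta> n \<le> 0"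
  using \<open>n > 0\<close>
proof (induction n rule: nat_induct_non_zero)
  case 1
  then show ?case using assms by (simp add: cesaro_number_def)
next
  case (Suc n)
  then show ?case using assms
    by (auto simp: cesaro_number_Suc divide_le_0_iff mult_le_0_iff)
qed

text \<open>These are the coefficients of \<open>(1 - x)\<close> to the power
  \<open>-\<beta> - 1\<close>; the binomial form opens the way to Vandermonde's identity.\<close>

lemma cesaro_number_gbinomial:
  "cesaro_number \<beta> n = (-1) ^ n * ((- \<beta> - 1) gchoose n)"
proof -
  have "pochhammer (\<beta> + 1) n = (\<Prod>i=1..n. \<beta> + real i)"
    by (induction n) (auto simp: pochhammer_Suc algebra_simps)
  then show ?thesis
    by (simp add: cesaro_number_def gbinomial_pochhammer algebra_simps flip: power_mult_distrib)
qed

lemma sum_cesaro_number: "(\<Sum>j\<le>n. cesaro_number \<beta> j) = cesaro_number (\<beta> + 1) n"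
proof -
  \<comment> \<open>Stated without dividing by \<open>\<beta> + 1\<close>, so that
    \<open>\<beta> = -1\<close> is covered.\<close>
  have step: "cesaro_number (\<beta> + 1) n * (\<beta> + 1) = cesaro_number \<beta> n * (\<beta> + 1 + real n)" for n
  proof (induction n)
    case (Suc n)
    have "cesaro_number (\<beta> + 1) (Suc n) * (\<beta> + 1)
        = (cesaro_number (\<beta> + 1) n * (\<beta> + 1)) * (\<beta> + 1 + real (Suc n)) / real (Suc n)"
      by (simp add: cesaro_number_Suc)
    then show ?case unfolding Suc by (simp add: cesaro_number_Suc algebra_simps)
  qed simp
  show ?thesis
  proof (induction n)
    case (Suc n)
    have "cesaro_number (\<beta> + 1) (Suc n)
        = cesaro_number (\<beta> + 1) n + (cesaro_number (\<beta> + 1) n * (\<beta> + 1)) / real (Suc n)"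
      by (simp add: cesaro_number_Suc field_simps)
    also have "\<dots> = cesaro_number (\<beta> + 1) n + cesaro_number \<beta> (Suc n)"
      unfolding step by (simp add: cesaro_number_Suc algebra_simps)
    finally show ?case using Suc by simp
  qed simp
qed

text \<open>Multiplying powers of \<open>1 - x\<close> adds exponents; on coefficients this is
  Vandermonde's identity.\<close>

lemma cesaro_number_convolution:
  "(\<Sum>i=0..n. cesaro_number \<beta> i * cesaro_number \<gamma> (n - i)) = cesaro_number (\<beta> + \<gamma> + 1) n"
proof -
  have "(\<Sum>i=0..n. cesaro_number \<beta> i * cesaro_number \<gamma> (n - i))
      = (\<Sum>i=0..n. (-1) ^ n * (((- \<beta> - 1) gchoose i) * ((- \<gamma> - 1) gchoose (n - i))))"
    by (intro sum.cong refl) (simp add: cesaro_number_gbinomial flip: power_add)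
  also have "\<dots> = (-1) ^ n * ((- \<beta> - 1 + (- \<gamma> - 1)) gchoose n)"
    by (simp add: gbinomial_Vandermonde flip: sum_distrib_left)
  finally show ?thesis by (simp add: cesaro_number_gbinomial algebra_simps)
qed

section \<open>Inversion of the Cesaro transform and Bosanquet's lemma\<close>

text \<open>The two kernels have generating functions \<open>(1 - x)\<close> to the powers
  \<open>-\<alpha>\<close> and \<open>\<alpha>\<close>, which are inverse to each other.\<close>

lemma cesaro_convolution_inverse:
  fixes y :: "nat \<Rightarrow> complex"
  shows "(\<Sum>m=0..n. of_real (cesaro_number (- \<alpha> - 1) (n - m)) *
           (\<Sum>p=0..m. of_real (cesaro_number (\<alpha> - 1) (m - p)) * y p)) = y n"
proof -
  define F where "F = Abs_fps (\<lambda>n. complex_of_real (cesaro_number (\<alpha> - 1) n))"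
  define G where "G = Abs_fps (\<lambda>n. complex_of_real (cesaro_number (- \<alpha> - 1) n))"
  have "F * G = 1"
  proof (rule fps_ext)
    fix n
    have "fps_nth (F * G) n
        = of_real (\<Sum>i=0..n. cesaro_number (\<alpha> - 1) i * cesaro_number (- \<alpha> - 1) (n - i))"
      by (simp add: F_def G_def fps_mult_nth)
    then show "fps_nth (F * G) n = fps_nth 1 n"
      \<comment> \<open>The orders combine to \<open>-1\<close>, and
        \<open>cesaro_number (-1)\<close> vanishes at every positive index.\<close>
      by (cases "n = 0") (auto simp: cesaro_number_convolution)
  qed
  then have "fps_nth ((Abs_fps y * F) * G) n = y n"
    by (simp add: mult.assoc)
  then have "(\<Sum>m=0..n. (\<Sum>p=0..m. y p * of_real (cesaro_number (\<alpha> - 1) (m - p))) *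
      of_real (cesaro_number (- \<alpha> - 1) (n - m))) = y n"
    by (simp add: fps_mult_nth F_def G_def)
  then show ?thesis by (simp add: mult.commute)
qed

text \<open>
  Bosanquet's lemma. The transform of the truncated sequence is, beyond the truncation index, a
  combination of its previous values with nonnegative weights of total mass at most one, so it
  obeys a maximum principle.
\<close>

lemma bosanquet:
  fixes x :: "nat \<Rightarrow> complex"
  assumes \<alpha>: "0 \<le> \<alpha>" "\<alpha> \<le> 1" and "1 \<le> v" "v \<le> n"
    and bound: "\<And>m. 1 \<le> m \<Longrightarrow> m \<le> v \<Longrightarrow>
      cmod (\<Sum>p=1..m. of_real (cesaro_number (\<alpha> - 1) (m - p)) * x p) \<le> M"
  shows "cmod (\<Sum>p=1..v. of_real (cesaro_number (\<alpha> - 1) (n - p)) * x p) \<le> M"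
proof -
  \<comment> \<open>Truncation at \<open>v\<close> makes the transform \<open>s\<close> agree with
    the hypothesis sums up to \<open>v\<close> and with the sum of the conclusion from
    \<open>v\<close> on.\<close>
  define y where "y p = (if 1 \<le> p \<and> p \<le> v then x p else 0)" for p
  define s where "s m = (\<Sum>p=0..m. of_real (cesaro_number (\<alpha> - 1) (m - p)) * y p)" for m
  define E where "E = cesaro_number (- \<alpha> - 1)"
  have "M \<ge> 0" using bound[of 1] \<open>1 \<le> v\<close> norm_ge_zero order_trans by blast
  have s_le: "s m = (\<Sum>p=1..m. of_real (cesaro_number (\<alpha> - 1) (m - p)) * x p)" if "m \<le> v" for m
    unfolding s_def using that by (intro sum.mono_neutral_cong_right) (auto simp: y_def)
  have s_ge: "s m = (\<Sum>p=1..v. of_real (cesaro_number (\<alpha> - 1) (m - p)) * x p)" if "v \<le> m" for m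
    unfolding s_def using that by (intro sum.mono_neutral_cong_right) (auto simp: y_def)
  have "cmod (s m) \<le> M" for m
  proof (induction m rule: less_induct)
    case (less m)
    show ?case
    proof (cases "m \<le> v")
      case True
      then show ?thesis using bound[of m] s_le[of m] \<open>M \<ge> 0\<close> by (cases "m = 0") auto
    next
      case False
      have "(\<Sum>j=0..m. of_real (E (m - j)) * s j) = 0"
        using cesaro_convolution_inverse[of \<alpha> m y] False by (simp add: E_def s_def y_def)
      \<comment> \<open>Inversion returns \<open>y m = 0\<close> beyond \<open>v\<close>; since
        \<open>E 0 = 1\<close>, the relation can be solved for \<open>s m\<close>.\<close>
      then have "s m = - (\<Sum>j<m. of_real (E (m - j)) * s j)"
        by (simp add: atLeast0AtMost lessThan_Suc_atMost[symmetric] E_def add_eq_0_iff)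
      then have "cmod (s m) \<le> (\<Sum>j<m. cmod (of_real (E (m - j)) * s j))"
        using norm_sum by (simp del: norm_mult)
      also have "\<dots> \<le> (\<Sum>j<m. - E (m - j) * M)"
      proof (rule sum_mono)
        fix j assume "j \<in> {..<m}"
        then have "E (m - j) \<le> 0" unfolding E_def using \<alpha> by (intro cesaro_number_nonpos) auto
        then show "cmod (of_real (E (m - j)) * s j) \<le> - E (m - j) * M"
          using less[of j] \<open>j \<in> {..<m}\<close> by (auto simp: norm_mult intro!: mult_left_mono mult_left_mono_neg)
      qed
      also have "\<dots> = - (\<Sum>j<m. E (Suc j)) * M"
        using sum.nat_diff_reindex[of "\<lambda>j. E (Suc j)" m]
        by (simp add: sum_distrib_right sum_negf Suc_diff_Suc flip: sum_distrib_right)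
      \<comment> \<open>The weights \<open>- E\<close> add up to
        \<open>1 - cesaro_number (- \<alpha>) m\<close>, which is at most 1 because the order
        \<open>- \<alpha>\<close> is at least \<open>-1\<close>.\<close>
      also have "(\<Sum>j<m. E (Suc j)) = cesaro_number (- \<alpha>) m - 1"
        using sum_cesaro_number[of "- \<alpha> - 1" m]
        by (simp add: E_def sum.atMost_shift)
      also have "- (cesaro_number (- \<alpha>) m - 1) * M \<le> 1 * M"
        using cesaro_number_nonneg[of "- \<alpha>" m] \<alpha> \<open>M \<ge> 0\<close> by (intro mult_right_mono) auto
      finally show ?thesis by simp
    qed
  qed
  then show ?thesis using s_ge[OF \<open>v \<le> n\<close>] by metis
qed

section \<open>Tangent inequalities for real powers and their consequences\<close>

lemma powr_ge_tangent_nonpos: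
  fixes t p :: real
  assumes "t > 0" "p \<le> 0"
  shows "1 + p * (t - 1) \<le> t powr p"
proof -
  have "p * (t - 1) \<le> p * ln t"
    using assms ln_le_minus_one[of t] by (intro mult_left_mono_neg) auto
  also have "1 + p * ln t \<le> exp (p * ln t)" by (rule exp_ge_add_one_self)
  finally show ?thesis using assms by (simp add: powr_def)
qed

text \<open>For positive \<open>t\<close> this is the nonpositive case with exponent
  \<open>1 - p\<close> at the point \<open>1 / t\<close>, multiplied by \<open>t\<close>.\<close>

lemma powr_ge_tangent:
  fixes t p :: real
  assumes "t \<ge> 0" "p \<ge> 1"
  shows "1 + p * (t - 1) \<le> t powr p"
proof (cases "t = 0")
  case False
  then have t: "t > 0" using assms by simp
  have "1 + p * (t - 1) = t * (1 + (1 - p) * (1 / t - 1))" using t by (simp add: field_simps)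
  also have "\<dots> \<le> t * (1 / t) powr (1 - p)"
    using t assms by (intro mult_left_mono powr_ge_tangent_nonpos) auto
  also have "\<dots> = t powr p"
    using t by (simp add: powr_divide powr_diff)
  finally show ?thesis .
qed (use assms in simp)

text \<open>Inverts the previous inequality: it is applied with exponent \<open>1 / p\<close> to the
  tangent value, which must first be seen to be nonnegative.\<close>

lemma powr_le_tangent:
  fixes t p :: real
  assumes "t \<ge> 0" "0 < p" "p \<le> 1"
  shows "t powr p \<le> 1 + p * (t - 1)"
proof -
  have "1 + p * (t - 1) = (1 - p) + p * t" by (simp add: algebra_simps)
  also have "0 \<le> \<dots>" using assms by simp
  finally have nonneg: "0 \<le> 1 + p * (t - 1)" .
  have "t = 1 + 1 / p * ((1 + p * (t - 1)) - 1)" using assms by simp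
  also have "\<dots> \<le> (1 + p * (t - 1)) powr (1 / p)"
    using nonneg assms by (intro powr_ge_tangent) auto
  finally have "t powr p \<le> ((1 + p * (t - 1)) powr (1 / p)) powr p"
    using assms by (intro powr_mono2) auto
  then show ?thesis using nonneg assms by (simp add: powr_powr)
qed

text \<open>Jensen's inequality for the \<open>k\<close>-th power with weights \<open>d\<close>,
  obtained by summing tangent inequalities at the weighted mean of \<open>u\<close>.\<close>

lemma Holder_sum_powr:
  fixes d u :: "'a \<Rightarrow> real"
  assumes "k \<ge> 1" "\<And>i. i \<in> I \<Longrightarrow> 0 \<le> d i" "\<And>i. i \<in> I \<Longrightarrow> 0 \<le> u i"
  shows "(\<Sum>i\<in>I. d i * u i) powr k \<le> (\<Sum>i\<in>I. d i) powr (k - 1) * (\<Sum>i\<in>I. d i * u i powr k)"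
proof -
  define D where "D = (\<Sum>i\<in>I. d i)"
  define W where "W = (\<Sum>i\<in>I. d i * u i)"
  have "D \<ge> 0" "W \<ge> 0" unfolding D_def W_def using assms by (auto intro!: sum_nonneg)
  have R: "(\<Sum>i\<in>I. d i * u i powr k) \<ge> 0" using assms by (auto intro!: sum_nonneg)
  show ?thesis
  proof (cases "W = 0")
    case True
    then show ?thesis using R by (simp add: W_def)
  next
    case False
    then have W: "W > 0" using \<open>W \<ge> 0\<close> by simp
    have "D \<noteq> 0"
    proof
      assume "D = 0"
      \<comment> \<open>A sum over an infinite set is 0 by convention, so
        \<open>W \<noteq> 0\<close> forces finiteness.\<close>
      moreover have "finite I" using False W_def by (metis sum.infinite)
      ultimately have "\<forall>i\<in>I. d i = 0" using assms D_def by (simp add: sum_nonneg_eq_0_iff)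
      then show False using False by (simp add: W_def)
    qed
    then have D: "D > 0" using \<open>D \<ge> 0\<close> by simp
    \<comment> \<open>With \<open>m\<close> the weighted mean, the linear parts of the tangents
      cancel in the weighted sum.\<close>
    define m where "m = W / D"
    have m: "m > 0" using W D by (simp add: m_def)
    have "D * m powr k = m powr k * (\<Sum>i\<in>I. d i * (1 + k * (u i / m - 1)))"
    proof -
      have "(\<Sum>i\<in>I. d i * (1 + k * (u i / m - 1))) = (\<Sum>i\<in>I. (1 - k) * d i + k / m * (d i * u i))"
        using m by (intro sum.cong) (auto simp: field_simps)
      also have "\<dots> = (1 - k) * D + k / m * W"
        by (simp add: sum.distrib D_def W_def sum_distrib_left)
      also have "\<dots> = D" using m W D by (simp add: m_def field_simps)
      finally show ?thesis by simp
    qed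
    also have "\<dots> \<le> m powr k * (\<Sum>i\<in>I. d i * (u i / m) powr k)"
      using assms m by (intro mult_left_mono sum_mono powr_ge_tangent) auto
    also have "\<dots> = (\<Sum>i\<in>I. d i * u i powr k)"
      unfolding sum_distrib_left using m assms by (intro sum.cong) (auto simp: powr_divide)
    finally have "D powr (k - 1) * (D * m powr k) \<le> D powr (k - 1) * (\<Sum>i\<in>I. d i * u i powr k)"
      by (intro mult_left_mono) auto
    moreover have "D powr (k - 1) * (D * m powr k) = W powr k"
      using D W by (simp add: m_def powr_divide powr_diff)
    ultimately show ?thesis by (simp add: D_def W_def)
  qed
qed

text \<open>Integral comparison in discrete form: each term is dominated by a telescoping
  difference.\<close>

lemma sum_powr_tail_le:
  fixes s :: real
  assumes "s > 1" "v \<ge> 1"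
  shows "(\<Sum>n=Suc v..N. real n powr (- s)) \<le> real v powr (1 - s) / (s - 1)"
proof -
  have "(\<Sum>n=Suc v..N. real n powr (- s)) \<le> (real v powr (1 - s) - real N powr (1 - s)) / (s - 1)"
    if "N \<ge> v" for N
    using that
  proof (induction N rule: dec_induct)
    case (step n)
    have n: "real n > 0" using step assms by simp
    \<comment> \<open>Tangent inequality at \<open>n / (n + 1)\<close>; rescaled, it bounds the new
      term by the difference of consecutive \<open>(1 - s)\<close>-th powers.\<close>
    have "1 + (1 - s) * (real n / real (Suc n) - 1) \<le> (real n / real (Suc n)) powr (1 - s)"
      using n assms by (intro powr_ge_tangent_nonpos) auto
    then have "real (Suc n) powr (1 - s) * (1 + (1 - s) * (real n / real (Suc n) - 1))
        \<le> real (Suc n) powr (1 - s) * (real n / real (Suc n)) powr (1 - s)"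
      by (intro mult_left_mono) auto
    also have "\<dots> = real n powr (1 - s)" using n by (simp add: powr_divide)
    also have "1 + (1 - s) * (real n / real (Suc n) - 1) = 1 + (s - 1) / real (Suc n)"
      by (simp add: field_simps)
    also have "real (Suc n) powr (1 - s) * (1 + (s - 1) / real (Suc n))
        = real (Suc n) powr (1 - s) + (s - 1) * real (Suc n) powr (- s)"
      using powr_mult_base[of "real (Suc n)" "- s", symmetric]
      by (simp add: distrib_left del: of_nat_Suc)
    finally have "real (Suc n) powr (- s) \<le> (real n powr (1 - s) - real (Suc n) powr (1 - s)) / (s - 1)"
      using assms by (simp add: field_simps)
    with step show ?case by (simp add: diff_divide_distrib)
  qed simp
  note * = this
  show ?thesis
  proof (cases "N \<ge> v")
    case True
    have "(real v powr (1 - s) - real N powr (1 - s)) / (s - 1) \<le> real v powr (1 - s) / (s - 1)"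
      using assms by (intro divide_right_mono) auto
    with *[OF True] show ?thesis by linarith
  qed (use assms in auto)
qed

text \<open>The quotient of \<open>cesaro_number \<alpha> m\<close> by the
  \<open>\<alpha>\<close>-th power of \<open>m + 1\<close> is nondecreasing. The constant 2 pays for
  replacing \<open>(v + 1) / (n + 1)\<close> by \<open>v / n\<close>.\<close>

lemma cesaro_number_ratio_le:
  assumes "0 < \<alpha>" "\<alpha> \<le> 1" "1 \<le> v" "v \<le> n"
  shows "cesaro_number \<alpha> v / cesaro_number \<alpha> n \<le> 2 * (real v / real n) powr \<alpha>"
proof -
  define g where "g m = cesaro_number \<alpha> m * real (Suc m) powr (- \<alpha>)" for m
  have pos: "cesaro_number \<alpha> m > 0" for m using assms by (intro cesaro_number_pos) auto
  have aux: "inverse x \<le> q * inverse y" if "0 < x" "0 < y" "y / x \<le> q" for x y q :: real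
    using that by (simp add: field_simps)
  have "g v \<le> g n"
  proof (rule lift_Suc_mono_le[OF _ \<open>v \<le> n\<close>])
    fix m
    \<comment> \<open>The tangent value here is exactly the ratio of consecutive Cesaro
      numbers.\<close>
    have "(real (Suc (Suc m)) / real (Suc m)) powr \<alpha>
        \<le> 1 + \<alpha> * (real (Suc (Suc m)) / real (Suc m) - 1)"
      using assms by (intro powr_le_tangent) auto
    also have "\<dots> = (\<alpha> + real (Suc m)) / real (Suc m)" by (simp add: field_simps)
    finally have "real (Suc (Suc m)) powr \<alpha> / real (Suc m) powr \<alpha>
        \<le> (\<alpha> + real (Suc m)) / real (Suc m)"
      by (simp add: powr_divide)
    then have "real (Suc m) powr (- \<alpha>)
        \<le> (\<alpha> + real (Suc m)) / real (Suc m) * real (Suc (Suc m)) powr (- \<alpha>)"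
      by (simp only: powr_minus) (rule aux, auto)
    then show "g m \<le> g (Suc m)"
      using mult_left_mono[of _ _ "cesaro_number \<alpha> m"] pos[of m]
      unfolding g_def cesaro_number_Suc by (fastforce simp: mult_ac)
  qed
  then have "cesaro_number \<alpha> v / cesaro_number \<alpha> n
      \<le> real (Suc v) powr \<alpha> / real (Suc n) powr \<alpha>"
    using pos[of n] by (simp add: g_def powr_minus field_simps)
  also have "\<dots> = (real (Suc v) / real (Suc n)) powr \<alpha>" by (simp add: powr_divide)
  also have "\<dots> \<le> (2 * (real v / real n)) powr \<alpha>"
  proof (rule powr_mono2)
    have "real (Suc v) * real n \<le> (2 * real v) * real (Suc n)"
      using assms by (intro mult_mono) auto
    then show "real (Suc v) / real (Suc n) \<le> 2 * (real v / real n)"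
      using assms by (simp add: field_simps)
  qed (use assms in auto)
  also have "\<dots> = 2 powr \<alpha> * (real v / real n) powr \<alpha>"
    using powr_mult[of 2 "real v / real n" \<alpha>] by simp
  also have "\<dots> \<le> 2 powr 1 * (real v / real n) powr \<alpha>"
    using assms by (intro mult_right_mono powr_mono) auto
  finally show ?thesis by simp
qed

section \<open>Summation by parts and elementary bounds\<close>

lemma sum_by_parts_bdiff:
  fixes l b :: "nat \<Rightarrow> 'a::comm_ring"
  shows "(\<Sum>v=1..n. l v * b v) = (\<Sum>v=1..<n. bdiff l v * (\<Sum>p=1..v. b p)) + l n * (\<Sum>p=1..n. b p)"
proof (induction n)
  case (Suc n)
  then show ?case by (cases "n = 0") (simp_all add: bdiff_def algebra_simps)
qed simp

text \<open>Positivity of \<open>g\<close> lets the finitely many indices below the threshold be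
  absorbed into the constant.\<close>

lemma bigo_imp_bound:
  fixes f g :: "nat \<Rightarrow> real"
  assumes "f \<in> O(g)" "\<And>n. n \<ge> 1 \<Longrightarrow> g n > 0"
  obtains C where "C > 0" "\<And>n. n \<ge> 1 \<Longrightarrow> \<bar>f n\<bar> \<le> C * g n"
proof -
  obtain c where c: "c > 0" "\<forall>\<^sub>F n in sequentially. norm (f n) \<le> c * norm (g n)"
    using landau_o.bigE[OF assms(1)] by blast
  then obtain N where N: "\<And>n. n \<ge> N \<Longrightarrow> norm (f n) \<le> c * norm (g n)"
    by (auto simp: eventually_sequentially)
  \<comment> \<open>The added sum dominates each single ratio with index up to
    \<open>N\<close>.\<close>
  define C where "C = c + (\<Sum>n=1..N. \<bar>f n\<bar> / g n)"
  have nn: "(\<Sum>n=1..N. \<bar>f n\<bar> / g n) \<ge> 0"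
    using assms(2) by (intro sum_nonneg divide_nonneg_nonneg) (auto simp: less_imp_le)
  show ?thesis
  proof (rule that[of C])
    show "C > 0" using c nn by (simp add: C_def)
    fix n :: nat assume n: "n \<ge> 1"
    show "\<bar>f n\<bar> \<le> C * g n"
    proof (cases "n \<ge> N")
      case True
      have "\<bar>f n\<bar> \<le> c * g n" using N[OF True] assms(2)[OF n] by simp
      also have "\<dots> \<le> C * g n" using nn assms(2)[OF n] by (intro mult_right_mono) (auto simp: C_def)
      finally show ?thesis .
    next
      case False
      have "\<bar>f n\<bar> / g n \<le> (\<Sum>n=1..N. \<bar>f n\<bar> / g n)"
        using n False assms(2) by (intro member_le_sum) (auto simp: less_imp_le)
      also have "\<dots> \<le> C" using c by (simp add: C_def)
      finally show ?thesis using assms(2)[OF n] by (simp add: field_simps)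
    qed
  qed
qed

lemma powr_add_le:
  fixes x y k :: real
  assumes "x \<ge> 0" "y \<ge> 0" "k \<ge> 0"
  shows "(x + y) powr k \<le> 2 powr k * (x powr k + y powr k)"
proof -
  have "(x + y) powr k \<le> (2 * max x y) powr k"
    using assms by (intro powr_mono2) auto
  also have "\<dots> = 2 powr k * max x y powr k"
    using powr_mult[of 2 "max x y" k] by simp
  also have "\<dots> \<le> 2 powr k * (x powr k + y powr k)"
    by (intro mult_left_mono) (auto simp: max_def)
  finally show ?thesis .
qed

section \<open>Estimates for Cesaro means of the factored sequence\<close>

text \<open>At \<open>\<alpha> = 1\<close> the quantity \<open>cesaro_max\<close> is a single mean
  rather than a maximum, hence the third hypothesis.\<close>

lemma cmod_cesaro_mean_le_cesaro_max:
  assumes "1 \<le> m" "m \<le> v" "\<alpha> = 1 \<Longrightarrow> m = v"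
  shows "cmod (cesaro_mean \<alpha> a m) \<le> cesaro_max \<alpha> a v"
  using assms unfolding cesaro_max_def by (auto intro!: Max_ge)

lemma cesaro_max_nonneg: "v \<ge> 1 \<Longrightarrow> cesaro_max \<alpha> a v \<ge> 0"
  using cmod_cesaro_mean_le_cesaro_max[of v v \<alpha> a] norm_ge_zero order_trans by blast

text \<open>For \<open>\<alpha> < 1\<close> Bosanquet's lemma replaces the kernel centred at
  \<open>n\<close> by kernels centred at \<open>m \<le> v\<close>, at the price of a maximum over
  \<open>m\<close>. For \<open>\<alpha> = 1\<close> the kernel is constantly 1, so the mean at
  \<open>v\<close> suffices.\<close>

lemma cmod_cesaro_partial_sum_le:
  assumes \<alpha>: "0 < \<alpha>" "\<alpha> \<le> 1" and v: "1 \<le> v" "v \<le> n"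
  shows "cmod (\<Sum>p=1..v. of_real (cesaro_number (\<alpha> - 1) (n - p)) * (of_nat p * a p))
           \<le> cesaro_number \<alpha> v * cesaro_max \<alpha> a v"
proof -
  have eq: "cmod (\<Sum>p=1..m. of_real (cesaro_number (\<alpha> - 1) (m - p)) * (of_nat p * a p))
      = cesaro_number \<alpha> m * cmod (cesaro_mean \<alpha> a m)" for m
    using cesaro_number_pos[of \<alpha> m] \<alpha>
    by (simp add: cesaro_mean_def norm_divide mult.assoc)
  show ?thesis
  proof (cases "\<alpha> = 1")
    case True
    have "cesaro_number 0 j = 1" for j
      by (induction j) (auto simp: cesaro_number_Suc)
    with eq[of v] True show ?thesis by (simp add: cesaro_max_def)
  next
    case False
    show ?thesis
    proof (rule bosanquet)
      fix m assume m: "1 \<le> m" "m \<le> v"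
      show "cmod (\<Sum>p=1..m. of_real (cesaro_number (\<alpha> - 1) (m - p)) * (of_nat p * a p))
           \<le> cesaro_number \<alpha> v * cesaro_max \<alpha> a v"
        unfolding eq using \<alpha> m False
        by (intro mult_mono cesaro_number_mono cmod_cesaro_mean_le_cesaro_max cesaro_number_nonneg) auto
    qed (use \<alpha> v in auto)
  qed
qed

lemma cmod_cesaro_mean_mult_le:
  assumes \<alpha>: "0 < \<alpha>" "\<alpha> \<le> 1" and n: "n \<ge> 1"
  shows "cmod (cesaro_mean \<alpha> (\<lambda>n. a n * lam n) n)
     \<le> 2 * real n powr (- \<alpha>) *
         (\<Sum>v=1..<n. cmod (bdiff lam v) * (real v powr \<alpha> * cesaro_max \<alpha> a v))
       + cmod (lam n) * cesaro_max \<alpha> a n"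
proof -
  \<comment> \<open>The kernel stays centred at \<open>n\<close> while the partial sums of
    \<open>b\<close> stop at \<open>v\<close>; this mismatch is what the partial sum bound
    handles.\<close>
  define b where "b p = complex_of_real (cesaro_number (\<alpha> - 1) (n - p)) * (of_nat p * a p)" for p
  define C where "C = cesaro_number \<alpha>"
  define w where "w = cesaro_max \<alpha> a"
  have C: "C v > 0" for v unfolding C_def using \<alpha> by (intro cesaro_number_pos) auto
  have B: "cmod (\<Sum>p=1..v. b p) \<le> C v * w v" if "1 \<le> v" "v \<le> n" for v
    unfolding b_def C_def w_def using \<alpha> that by (rule cmod_cesaro_partial_sum_le)
  have "cesaro_mean \<alpha> (\<lambda>n. a n * lam n) n = (\<Sum>v=1..n. lam v * b v) / of_real (C n)"
    unfolding cesaro_mean_def b_def C_def by (intro arg_cong2[of _ _ _ _ "(/)"] sum.cong) auto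
  also have "cmod \<dots> = cmod (\<Sum>v=1..n. lam v * b v) / C n"
    using C[of n] by (simp add: norm_divide)
  also have "\<dots> \<le> ((\<Sum>v=1..<n. cmod (bdiff lam v) * (C v * w v)) + cmod (lam n) * (C n * w n)) / C n"
    unfolding sum_by_parts_bdiff using C[of n] n
    by (intro divide_right_mono norm_triangle_mono sum_norm_le)
       (auto simp: norm_mult intro!: mult_left_mono B[simplified])
  also have "\<dots> = (\<Sum>v=1..<n. cmod (bdiff lam v) * (C v / C n * w v)) + cmod (lam n) * w n"
    using C[of n] by (simp add: add_divide_distrib sum_divide_distrib mult_ac)
  also have "(\<Sum>v=1..<n. cmod (bdiff lam v) * (C v / C n * w v))
      \<le> (\<Sum>v=1..<n. cmod (bdiff lam v) * (2 * (real v / real n) powr \<alpha> * w v))"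
    unfolding C_def w_def using \<alpha>
    by (intro sum_mono mult_left_mono mult_right_mono cesaro_number_ratio_le cesaro_max_nonneg) auto
  also have "\<dots> = 2 * real n powr (- \<alpha>) *
      (\<Sum>v=1..<n. cmod (bdiff lam v) * (real v powr \<alpha> * w v))"
  proof -
    have "(real v / real n) powr \<alpha> = real n powr (- \<alpha>) * real v powr \<alpha>" for v
      by (simp add: powr_divide powr_minus_divide)
    then show ?thesis by (simp add: sum_distrib_left mult_ac)
  qed
  finally show ?thesis by (simp add: w_def)
qed

section \<open>The two weighted sums\<close>

text \<open>Controls the part containing the differences of \<open>lam\<close>. The factor
  \<open>D / x0\<close> comes from Hoelder's inequality,
  \<open>1 / (k * \<alpha> + \<epsilon> - 1)\<close> from the tail over \<open>n\<close>.\<close>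

lemma weighted_Hardy_sum_bounded:
  fixes k \<alpha> \<epsilon> C D x0 :: real and d w f X :: "nat \<Rightarrow> real"
  assumes k: "k \<ge> 1" and s: "k * \<alpha> + \<epsilon> > 1" and x0: "x0 > 0" and C: "C \<ge> 0"
    and d: "\<And>v. v \<ge> 1 \<Longrightarrow> 0 \<le> d v" and w: "\<And>v. v \<ge> 1 \<Longrightarrow> 0 \<le> w v"
    and f: "\<And>v. v \<ge> 1 \<Longrightarrow> 0 \<le> f v" and X: "\<And>v. v \<ge> 1 \<Longrightarrow> x0 \<le> X v"
    and dX: "\<And>N. (\<Sum>v=1..N. real v * d v * X v) \<le> D"
    and anti: "antimono_on {1..} (\<lambda>n. real n powr (\<epsilon> - k) * f n powr k)"
    and S: "\<And>m. m \<ge> 1 \<Longrightarrow> (\<Sum>n=1..m. real n powr (- k) * (w n * f n) powr k) \<le> C * X m"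
  shows "(\<Sum>n=1..N. real n powr (- k) * f n powr k *
            (real n powr (- \<alpha>) * (\<Sum>v=1..<n. d v * (real v powr \<alpha> * w v))) powr k)
         \<le> (D / x0) powr (k - 1) * (C * D / (k * \<alpha> + \<epsilon> - 1))"
proof -
  define s where "s = k * \<alpha> + \<epsilon>"
  define F where "F n = real n powr (\<epsilon> - k) * f n powr k" for n
  define Q where "Q v = d v * (real v powr \<alpha> * w v) powr k" for v
  define P where "P n = real n powr (- k) * (w n * f n) powr k" for n
  have "s > 1" using s by (simp add: s_def)
  have Q0: "Q v \<ge> 0" if "v \<ge> 1" for v using d[OF that] by (simp add: Q_def)
  have D0: "D \<ge> 0" using dX[of 0] by simp
  \<comment> \<open>Since \<open>1 \<le> v\<close> and \<open>x0 \<le> X v\<close>, each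
    \<open>d v\<close> is at most \<open>v * d v * X v / x0\<close>.\<close>
  have sum_d: "(\<Sum>v=1..<n. d v) \<le> D / x0" for n
  proof -
    have "x0 * (\<Sum>v=1..<n. d v) = (\<Sum>v=1..<n. 1 * d v * x0)"
      by (simp add: sum_distrib_left mult_ac)
    also have "\<dots> \<le> (\<Sum>v=1..<n. real v * d v * X v)"
      using d X x0 by (intro sum_mono mult_mono) auto
    also have "\<dots> \<le> (\<Sum>v=1..n. real v * d v * X v)"
    proof (rule sum_mono2)
      show "0 \<le> real b * d b * X b" if "b \<in> {1..n} - {1..<n}" for b
        using that d[of b] X[of b] x0 by (intro mult_nonneg_nonneg) auto
    qed auto
    also have "\<dots> \<le> D" by (rule dX)
    finally show ?thesis using x0 by (simp add: field_simps)
  qed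
  have P_le: "P v \<le> C * X v" if "v \<ge> 1" for v
  proof -
    have "P v \<le> (\<Sum>n=1..v. P n)"
      using that by (intro member_le_sum) (auto simp: P_def)
    also have "\<dots> \<le> C * X v" using S[OF that] by (simp add: P_def)
    finally show ?thesis .
  qed
  have "(\<Sum>n=1..N. real n powr (- k) * f n powr k *
          (real n powr (- \<alpha>) * (\<Sum>v=1..<n. d v * (real v powr \<alpha> * w v))) powr k)
      \<le> (\<Sum>n=1..N. F n * real n powr (- s) * ((D / x0) powr (k - 1) * (\<Sum>v=1..<n. Q v)))"
  proof (rule sum_mono)
    fix n assume "n \<in> {1..N}"
    then have n: "n \<ge> 1" by simp
    let ?H = "\<Sum>v=1..<n. d v * (real v powr \<alpha> * w v)"
    have H0: "?H \<ge> 0" using d w by (intro sum_nonneg) auto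
    have "?H powr k \<le> (\<Sum>v=1..<n. d v) powr (k - 1) * (\<Sum>v=1..<n. Q v)"
      unfolding Q_def using k d w by (intro Holder_sum_powr) auto
    also have "\<dots> \<le> (D / x0) powr (k - 1) * (\<Sum>v=1..<n. Q v)"
      using k d Q0 by (intro mult_right_mono powr_mono2 sum_d sum_nonneg) auto
    finally have H: "?H powr k \<le> (D / x0) powr (k - 1) * (\<Sum>v=1..<n. Q v)" .
    have "real n powr (- k) * f n powr k * (real n powr (- \<alpha>) * ?H) powr k
        = (real n powr (- k) * real n powr (- \<alpha> * k)) * f n powr k * ?H powr k"
      using H0 by (simp add: powr_mult powr_powr mult_ac)
    \<comment> \<open>Splits off the monotone factor \<open>F n\<close>, leaving the summable power
      with exponent \<open>- s\<close>.\<close>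
    also have "real n powr (- k) * real n powr (- \<alpha> * k) = real n powr (\<epsilon> - k) * real n powr (- s)"
      by (simp add: s_def algebra_simps flip: powr_add)
    also have "\<dots> * f n powr k * ?H powr k = F n * real n powr (- s) * ?H powr k"
      by (simp add: F_def mult_ac)
    also have "\<dots> \<le> F n * real n powr (- s) * ((D / x0) powr (k - 1) * (\<Sum>v=1..<n. Q v))"
      using H by (intro mult_left_mono) (auto simp: F_def)
    finally show "real n powr (- k) * f n powr k * (real n powr (- \<alpha>) * ?H) powr k
        \<le> F n * real n powr (- s) * ((D / x0) powr (k - 1) * (\<Sum>v=1..<n. Q v))" .
  qed
  also have "\<dots> = (D / x0) powr (k - 1) * (\<Sum>n=1..N. \<Sum>v=1..<n. Q v * (F n * real n powr (- s)))"
    by (simp add: sum_distrib_left sum_distrib_right mult_ac)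
  \<comment> \<open>Both sides run over the pairs \<open>1 \<le> v < n \<le> N\<close>;
    \<open>v = N\<close> adds only an empty inner sum.\<close>
  also have "(\<Sum>n=1..N. \<Sum>v=1..<n. Q v * (F n * real n powr (- s)))
      = (\<Sum>v=1..N. \<Sum>n=Suc v..N. Q v * (F n * real n powr (- s)))"
    by (subst sum.Sigma, simp, simp, subst sum.Sigma, simp, simp)
       (intro sum.reindex_bij_witness[of _ "\<lambda>(v, n). (n, v)" "\<lambda>(n, v). (v, n)"]; auto)
  also have "\<dots> \<le> (\<Sum>v=1..N. C / (s - 1) * (real v * d v * X v))"
  proof (rule sum_mono)
    fix v assume "v \<in> {1..N}"
    then have v: "v \<ge> 1" by simp
    have "(\<Sum>n=Suc v..N. Q v * (F n * real n powr (- s)))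
        \<le> (\<Sum>n=Suc v..N. Q v * (F v * real n powr (- s)))"
      using v Q0 monotone_onD[OF anti, of v]
      by (intro sum_mono mult_left_mono mult_right_mono) (auto simp: F_def)
    also have "\<dots> = Q v * F v * (\<Sum>n=Suc v..N. real n powr (- s))"
      by (simp add: sum_distrib_left mult_ac)
    also have "\<dots> \<le> Q v * F v * (real v powr (1 - s) / (s - 1))"
      using v Q0[of v] \<open>s > 1\<close> by (intro mult_left_mono sum_powr_tail_le) (auto simp: F_def)
    also have "Q v * F v * (real v powr (1 - s) / (s - 1)) = real v * d v * P v / (s - 1)"
    proof -
      \<comment> \<open>The exponents add up to \<open>1 - k\<close>, which yields
        \<open>P v\<close> together with the factor \<open>v\<close> needed to match
        \<open>dX\<close>.\<close>
      have "real v powr (\<alpha> * k) * real v powr (\<epsilon> - k) * real v powr (1 - s)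
          = real v powr (1 + - k)"
        by (simp add: s_def algebra_simps flip: powr_add)
      also have "\<dots> = real v * real v powr (- k)"
        using v by (intro powr_mult_base[symmetric]) auto
      finally show ?thesis
        using v w[of v] f[of v] unfolding Q_def F_def P_def
        by (simp add: powr_mult powr_powr mult_ac)
    qed
    also have "\<dots> \<le> real v * d v * (C * X v) / (s - 1)"
      using v d \<open>s > 1\<close> P_le by (intro divide_right_mono mult_left_mono) auto
    finally show "(\<Sum>n=Suc v..N. Q v * (F n * real n powr (- s)))
        \<le> C / (s - 1) * (real v * d v * X v)"
      by (simp add: mult_ac)
  qed
  also have "\<dots> = C / (s - 1) * (\<Sum>v=1..N. real v * d v * X v)"
    by (simp add: sum_distrib_left)
  also have "\<dots> \<le> C / (s - 1) * D"
    using C \<open>s > 1\<close> dX by (intro mult_left_mono) auto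
  finally show ?thesis
    by (simp add: s_def mult_left_mono)
qed

text \<open>Abel summation trades \<open>P\<close> for its partial sums, bounded by
  \<open>C * X\<close>: the differences of \<open>l\<close> contribute \<open>C * D\<close>, the
  boundary term \<open>C * L\<close>.\<close>

lemma sum_mult_le_by_parts:
  fixes l P X :: "nat \<Rightarrow> real"
  assumes "C \<ge> 0" and l: "\<And>n. n \<ge> 1 \<Longrightarrow> 0 \<le> l n"
    and S: "\<And>m. m \<ge> 1 \<Longrightarrow> 0 \<le> (\<Sum>n=1..m. P n) \<and> (\<Sum>n=1..m. P n) \<le> C * X m"
    and d: "\<And>n. n \<ge> 1 \<Longrightarrow> \<bar>bdiff l n\<bar> \<le> d n"
    and dX: "\<And>N. (\<Sum>v=1..<N. d v * X v) \<le> D"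
    and lX: "\<And>n. n \<ge> 1 \<Longrightarrow> l n * X n \<le> L" and "N \<ge> 1"
  shows "(\<Sum>n=1..N. l n * P n) \<le> C * D + C * L"
proof -
  have "(\<Sum>v=1..<N. bdiff l v * (\<Sum>p=1..v. P p)) \<le> (\<Sum>v=1..<N. d v * (C * X v))"
  proof (rule sum_mono)
    fix v assume "v \<in> {1..<N}"
    then have v: "v \<ge> 1" by simp
    have "bdiff l v * (\<Sum>p=1..v. P p) \<le> \<bar>bdiff l v\<bar> * (\<Sum>p=1..v. P p)"
      using S[OF v] by (intro mult_right_mono) auto
    also have "\<dots> \<le> d v * (C * X v)"
      using S[OF v] d[OF v] by (intro mult_mono) auto
    finally show "bdiff l v * (\<Sum>p=1..v. P p) \<le> d v * (C * X v)" .
  qed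
  also have "\<dots> = C * (\<Sum>v=1..<N. d v * X v)" by (simp add: sum_distrib_left mult_ac)
  also have "\<dots> \<le> C * D" using \<open>C \<ge> 0\<close> dX by (intro mult_left_mono) auto
  finally have 1: "(\<Sum>v=1..<N. bdiff l v * (\<Sum>p=1..v. P p)) \<le> C * D" .
  have "l N * (\<Sum>p=1..N. P p) \<le> l N * (C * X N)"
    using S[OF \<open>N \<ge> 1\<close>] l[OF \<open>N \<ge> 1\<close>] by (intro mult_left_mono) auto
  also have "\<dots> = C * (l N * X N)" by simp
  also have "\<dots> \<le> C * L" using \<open>C \<ge> 0\<close> lX[OF \<open>N \<ge> 1\<close>] by (intro mult_left_mono) auto
  finally show ?thesis using 1 unfolding sum_by_parts_bdiff by simp
qed

section \<open>Summability of the factored series\<close>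

theorem mainTheorem1:
  fixes k \<alpha> \<epsilon> :: real
    and a \<phi> lam :: "nat \<Rightarrow> complex"
    and X A \<delta> :: "nat \<Rightarrow> real"
  assumes "k \<ge> 1" and "0 < \<alpha>" and "\<alpha> \<le> 1"
    and "almost_increasing X"
    and "(\<lambda>n. cmod (lam n) * X n) \<in> O(\<lambda>_. 1)"
    and "quasi_monotone \<delta> A"
    and "summable (\<lambda>n. real (Suc n) * A (Suc n) * X (Suc n))"
    and "\<And>n. n \<ge> 1 \<Longrightarrow> cmod (bdiff lam n) \<le> \<bar>A n\<bar>"
    and "\<epsilon> > 0" and "k * \<alpha> + \<epsilon> > 1"
    and "antimono_on {1..} (\<lambda>n. real n powr (\<epsilon> - k) * cmod (\<phi> n) powr k)"
    and "(\<lambda>m. \<Sum>n=1..m. real n powr (- k) * (cesaro_max \<alpha> a n * cmod (\<phi> n)) powr k) \<in> O(X)"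
  shows "phi_cesaro_summable \<phi> \<alpha> k (\<lambda>n. a n * lam n)"
proof -
  note k = assms(1) and \<alpha> = assms(2,3)
  define w where "w = cesaro_max \<alpha> a"
  define f where "f n = cmod (\<phi> n)" for n
  define l where "l n = cmod (lam n)" for n
  define d where "d n = cmod (bdiff lam n)" for n
  define P where "P n = real n powr (- k) * (w n * f n) powr k" for n
  have w: "w n \<ge> 0" if "n \<ge> 1" for n unfolding w_def using that by (rule cesaro_max_nonneg)
  \<comment> \<open>The lower comparison with an increasing sequence keeps \<open>X\<close> away
    from 0; \<open>B\<close> below is the lower constant.\<close>
  obtain x0 where x0: "x0 > 0" "\<And>n. n \<ge> 1 \<Longrightarrow> x0 \<le> X n"
  proof -
    from assms(4) obtain c B where c: "\<And>n::nat. n \<ge> 1 \<Longrightarrow> 0 < c n" "mono_on {1..} c"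
      "B > 0" "\<And>n. n \<ge> 1 \<Longrightarrow> B * c n \<le> X n"
      unfolding almost_increasing_def by blast
    show ?thesis
    proof (rule that[of "B * c 1"])
      show "B * c 1 > 0" using c by simp
      fix n :: nat assume "n \<ge> 1"
      then have "B * c 1 \<le> B * c n" using c by (intro mult_left_mono mono_onD[OF c(2)]) auto
      then show "B * c 1 \<le> X n" using c(4)[OF \<open>n \<ge> 1\<close>] by simp
    qed
  qed
  then have X: "X n > 0" if "n \<ge> 1" for n using that by fastforce
  obtain C where C: "C > 0" "\<And>m. m \<ge> 1 \<Longrightarrow> \<bar>\<Sum>n=1..m. P n\<bar> \<le> C * X m"
    using bigo_imp_bound[OF assms(12) X] unfolding P_def w_def f_def by blast
  obtain L where L: "L > 0" "\<And>n. n \<ge> 1 \<Longrightarrow> l n * X n \<le> L"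
  proof -
    obtain L where "L > 0" "\<And>n. n \<ge> 1 \<Longrightarrow> \<bar>cmod (lam n) * X n\<bar> \<le> L * 1"
      by (rule bigo_imp_bound[OF assms(5)]) auto
    then show ?thesis using that[of L] by (fastforce simp: l_def)
  qed
  obtain D where D: "\<And>N. (\<Sum>v=1..N. real v * d v * X v) \<le> D"
  proof -
    \<comment> \<open>Ultimate positivity of \<open>A\<close> turns the assumed convergence into
      absolute convergence, as finitely many terms do not matter.\<close>
    have "\<forall>\<^sub>F n in sequentially. 0 < A (Suc n)"
      using assms(6) unfolding quasi_monotone_def
      by (subst eventually_sequentially_Suc) blast
    then have "\<forall>\<^sub>F n in sequentially. real (Suc n) * \<bar>A (Suc n)\<bar> * X (Suc n)
        = real (Suc n) * A (Suc n) * X (Suc n)"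
      by eventually_elim simp
    then have sm: "summable (\<lambda>n. real (Suc n) * \<bar>A (Suc n)\<bar> * X (Suc n))"
      using assms(7) by (rule summable_cong[THEN iffD2])
    show ?thesis
    proof (rule that)
      fix N
      have "(\<Sum>v=1..N. real v * d v * X v) = (\<Sum>v<N. real (Suc v) * d (Suc v) * X (Suc v))"
        by (intro sum.reindex_bij_witness[of _ Suc "\<lambda>v. v - 1"]) auto
      also have "\<dots> \<le> (\<Sum>v<N. real (Suc v) * \<bar>A (Suc v)\<bar> * X (Suc v))"
        using X assms(8) unfolding d_def
        by (intro sum_mono mult_right_mono mult_left_mono) (auto simp: less_imp_le)
      also have "\<dots> \<le> (\<Sum>v. real (Suc v) * \<bar>A (Suc v)\<bar> * X (Suc v))"
        using X by (intro sum_le_suminf sm) (auto simp: less_imp_le)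
      finally show "(\<Sum>v=1..N. real v * d v * X v)
          \<le> (\<Sum>v. real (Suc v) * \<bar>A (Suc v)\<bar> * X (Suc v))" .
    qed
  qed
  have P0: "P n \<ge> 0" for n by (simp add: P_def)
  have d0: "d n \<ge> 0" for n by (simp add: d_def)
  define K1 where "K1 = (D / x0) powr (k - 1) * (C * D / (k * \<alpha> + \<epsilon> - 1))"
  define K2 where "K2 = (L / x0) powr (k - 1) * (C * D + C * L)"
  define H where "H n = real n powr (- \<alpha>) * (\<Sum>v=1..<n. d v * (real v powr \<alpha> * w v))" for n
  define T where "T = cesaro_mean \<alpha> (\<lambda>n. a n * lam n)"
  have H0: "H n \<ge> 0" for n using d0 w unfolding H_def by (intro mult_nonneg_nonneg sum_nonneg) auto
  have K1: "(\<Sum>n=1..N. real n powr (- k) * f n powr k * H n powr k) \<le> K1" for N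
    unfolding K1_def H_def
  proof (rule weighted_Hardy_sum_bounded[where X = X])
    show "antimono_on {1..} (\<lambda>n. real n powr (\<epsilon> - k) * f n powr k)"
      using assms(11) by (simp add: f_def)
    show "(\<Sum>n=1..m. real n powr (- k) * (w n * f n) powr k) \<le> C * X m" if "m \<ge> 1" for m
      using C(2)[OF that] by (simp add: P_def)
  qed (use k assms(10) x0 C d0 w D in \<open>auto simp: f_def\<close>)
  have lP: "(\<Sum>n=1..N. l n * P n) \<le> C * D + C * L" if "N \<ge> 1" for N
  proof (rule sum_mult_le_by_parts[where X = X and d = d])
    show "0 \<le> (\<Sum>n=1..m. P n) \<and> (\<Sum>n=1..m. P n) \<le> C * X m" if "m \<ge> 1" for m
      using C(2)[OF that] P0 by (auto intro: sum_nonneg)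
    show "\<bar>bdiff l n\<bar> \<le> d n" for n
      unfolding bdiff_def l_def d_def by (rule norm_triangle_ineq3)
    show "(\<Sum>v=1..<N. d v * X v) \<le> D" for N
    proof -
      have "(\<Sum>v=1..<N. d v * X v) \<le> (\<Sum>v=1..<N. real v * d v * X v)"
      proof (rule sum_mono)
        fix v assume v: "v \<in> {1..<N}"
        then have "1 * (d v * X v) \<le> real v * (d v * X v)"
          using d0[of v] X[of v] by (intro mult_right_mono) auto
        then show "d v * X v \<le> real v * d v * X v" by (simp add: mult_ac)
      qed
      also have "\<dots> \<le> (\<Sum>v=1..N. real v * d v * X v)"
        using d0 X by (intro sum_mono2) (auto simp: less_imp_le)
      finally show ?thesis using D[of N] by linarith
    qed
  qed (use C L that in \<open>auto simp: l_def\<close>)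
  have K2: "(\<Sum>n=1..N. real n powr (- k) * f n powr k * (l n * w n) powr k) \<le> K2" if "N \<ge> 1" for N
  proof -
    have "(\<Sum>n=1..N. real n powr (- k) * f n powr k * (l n * w n) powr k)
        \<le> (\<Sum>n=1..N. (L / x0) powr (k - 1) * (l n * P n))"
    proof (rule sum_mono)
      fix n assume "n \<in> {1..N}"
      then have n: "n \<ge> 1" by simp
      have l0: "l n \<ge> 0" by (simp add: l_def)
      have "l n * x0 \<le> l n * X n" using x0(2)[OF n] l0 by (intro mult_left_mono)
      then have "l n \<le> L / x0" using L(2)[OF n] x0(1) by (simp add: field_simps)
      \<comment> \<open>Of the \<open>k\<close> powers of \<open>l n\<close>, \<open>k - 1\<close>
        are absorbed by the bound \<open>L / x0\<close>; the remaining one is kept for summation by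
        parts.\<close>
      then have "l n * l n powr (k - 1) \<le> l n * (L / x0) powr (k - 1)"
        using l0 k by (intro mult_left_mono powr_mono2) auto
      moreover have "l n * l n powr (k - 1) = l n powr k"
        using powr_mult_base[OF l0, of "k - 1"] by simp
      ultimately have "l n powr k * P n \<le> l n * (L / x0) powr (k - 1) * P n"
        using P0 by (intro mult_right_mono) auto
      moreover have "real n powr (- k) * f n powr k * (l n * w n) powr k = l n powr k * P n"
        using l0 w[OF n] by (simp add: P_def powr_mult f_def)
      ultimately show "real n powr (- k) * f n powr k * (l n * w n) powr k
          \<le> (L / x0) powr (k - 1) * (l n * P n)"
        by (simp add: mult_ac)
    qed
    also have "\<dots> \<le> K2"
      unfolding K2_def sum_distrib_left[symmetric] using lP[OF that] by (intro mult_left_mono) auto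
    finally show ?thesis .
  qed
  \<comment> \<open>The outer \<open>2 powr k\<close> comes from splitting the power of a sum, the
    inner one from the coefficient 2 of \<open>H n\<close>.\<close>
  have T_le: "real n powr (- k) * cmod (\<phi> n * T n) powr k
      \<le> 2 powr k * (2 powr k * (real n powr (- k) * f n powr k * H n powr k)
          + real n powr (- k) * f n powr k * (l n * w n) powr k)" if n: "n \<ge> 1" for n
  proof -
    have lw: "l n * w n \<ge> 0" using w[OF n] by (simp add: l_def)
    have "cmod (T n) \<le> 2 * H n + l n * w n"
      using cmod_cesaro_mean_mult_le[OF \<alpha> n, of a lam]
      by (simp add: T_def H_def l_def w_def d_def)
    then have "cmod (T n) powr k \<le> (2 * H n + l n * w n) powr k"
      using k by (intro powr_mono2) auto
    also have "\<dots> \<le> 2 powr k * ((2 * H n) powr k + (l n * w n) powr k)"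
      using H0 lw k by (intro powr_add_le) auto
    finally have "real n powr (- k) * f n powr k * cmod (T n) powr k
        \<le> real n powr (- k) * f n powr k * (2 powr k * ((2 * H n) powr k + (l n * w n) powr k))"
      by (intro mult_left_mono) auto
    then show ?thesis
      using H0[of n] by (simp add: norm_mult powr_mult f_def algebra_simps)
  qed
  show ?thesis
    unfolding phi_cesaro_summable_def T_def[symmetric]
  proof (rule bounded_imp_summable)
    fix N
    \<comment> \<open>In unshifted indices the range is \<open>1..Suc N\<close>, never empty, so
      \<open>K2\<close> applies for every \<open>N\<close>.\<close>
    have "(\<Sum>n\<le>N. real (Suc n) powr (- k) * cmod (\<phi> (Suc n) * T (Suc n)) powr k)
        = (\<Sum>n=1..Suc N. real n powr (- k) * cmod (\<phi> n * T n) powr k)"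
      by (intro sum.reindex_bij_witness[of _ "\<lambda>v. v - 1" Suc]) auto
    also have "\<dots> \<le> (\<Sum>n=1..Suc N. 2 powr k * (2 powr k * (real n powr (- k) * f n powr k * H n powr k)
          + real n powr (- k) * f n powr k * (l n * w n) powr k))"
      by (intro sum_mono T_le) auto
    also have "\<dots> = 2 powr k * (2 powr k * (\<Sum>n=1..Suc N. real n powr (- k) * f n powr k * H n powr k)
          + (\<Sum>n=1..Suc N. real n powr (- k) * f n powr k * (l n * w n) powr k))"
      by (simp only: sum.distrib flip: sum_distrib_left)
    also have "\<dots> \<le> 2 powr k * (2 powr k * K1 + K2)"
      by (intro mult_left_mono add_mono K1 K2) auto
    finally show "(\<Sum>n\<le>N. real (Suc n) powr (- k) * cmod (\<phi> (Suc n) * T (Suc n)) powr k)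
        \<le> 2 powr k * (2 powr k * K1 + K2)" .
  qed auto
qed

end
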